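(* Let $\mathcal{B}, X_0, X_1$ be Banach spaces and let $j_0: X_1\to X_0$ be an injective bounded linear map. Let $A_1\subset X_1$ be closed and non-empty, and let $A_0=j_0(A_1)\subset X_0$. Let $u_0\in\mathcal{B}$ and let $\mathcal{U}$ be a neighborhood of $u_0$ in $\mathcal{B}$. For $i\in\{0,1\}$ let $F_i:\mathcal{U}\times A_i\to A_i$ be continuous maps such that $$F_0(u,j_0(\phi_1))=j_0(F_1(u,\phi_1))\qquad\text{for all }u\in\mathcal{U},\ \phi_1\in A_1 .$$ Assume moreover: (i) For every $u\in\mathcal{U}$, the map $F_1(u,\cdot):A_1\to A_1$ admits a fixed point $\phi_1(u)\in A_1$, and the map $u\in\mathcal{U}\mapsto\phi_1(u)\in X_1$ is continuous. (ii) Put $\phi_0(u)=j_0(\phi_1(u))$ for $u\in\mathcal U$ and $\phi_0=\phi_0(u_0)$. There exist $P_0\in L(\mathcal{B},X_0)$ and $Q_0\in L(j_0(X_1),X_0)$ such that $$F_0(u_0+h,\phi_0+z_0)-F_0(u_0,\phi_0)=P_0 h+Q_0 z_0+\big(\|h\|_{\mathcal{B}}+\|z_0\|_{X_0}\big)\,\epsilon(h,z_1)$$ for all $h\in\mathcal{B}$ with $u_0+h\in\mathcal{U}$ and all $z_1\in X_1$ with $\phi_1(u_0)+z_1\in A_1$, where $z_0=j_0(z_1)$, and where $\epsilon(h,z_1)\to 0$ in $X_0$ as $(h,z_1)\to(0,0)$ in $\mathcal{B}\times X_1$. (iii) $Id-Q_0\in L(j_0(X_1),X_0)$ can be extended to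 a bounded, invertible operator of $X_0$ into itself. Then: (i)' The map $u\in\mathcal{U}\mapsto\phi_0(u)=j_0(\phi_1(u))\in X_0$ is differentiable at $u=u_0$. (ii)' Its differential satisfies $D_u\phi_0(u_0)=(Id-Q_0)^{-1}P_0$.
   Context: $L(E,F)$ denotes the space of bounded linear operators from $E$ to $F$. The subspace $j_0(X_1)\subset X_0$ is regarded as a normed space with the norm of $X_0$. In (ii)', $(Id-Q_0)^{-1}$ denotes the inverse of the extension of $Id-Q_0$ to $X_0$. Differentiability at $u_0$ means: there is a bounded linear operator $D_u\phi_0(u_0):\mathcal{B}\to X_0$ such that $\|\phi_0(u_0+h)-\phi_0(u_0)-D_u\phi_0(u_0)h\|_{X_0}=o(\|h\|_{\mathcal{B}})$ as $h\to0$ with $u_0+h\in\mathcal{U}$. *)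

theory Defs
  imports "HOL-Analysis.Analysis"
begin

text \<open>
  Membership in \<open>L(S, F)\<close> for a linear subspace \<open>S\<close> of a normed space, with \<open>S\<close> carrying the
  norm of the ambient space. The operator is represented by a total function whose values outside
  \<open>S\<close> are irrelevant.
\<close>

definition bounded_linear_on ::
    "'a::real_normed_vector set \<Rightarrow> ('a \<Rightarrow> 'b::real_normed_vector) \<Rightarrow> bool" where
  "bounded_linear_on S f \<longleftrightarrow>
     subspace S \<and>
     (\<forall>x\<in>S. \<forall>y\<in>S. f (x + y) = f x + f y) \<and>
     (\<forall>c. \<forall>x\<in>S. f (c *\<^sub>R x) = c *\<^sub>R f x) \<and>
     (\<exists>K. \<forall>x\<in>S. norm (f x) \<le> norm x * K)"

end

theory Submission
  imports Defs
begin

text \<open>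
  Write \<open>z\<^sub>1 = \<phi>1 u - \<phi>1 u0\<close>, \<open>z\<^sub>0 = j0 z\<^sub>1 = \<phi>0 u - \<phi>0 u0\<close> and \<open>h = u - u0\<close>. The points \<open>\<phi>0 u\<close>
  and \<open>\<phi>0 u0\<close> are fixed points of \<open>F0 u\<close> and \<open>F0 u0\<close>, so the expansion of \<open>F0\<close> is an equation for
  \<open>z\<^sub>0\<close> itself, namely \<open>z\<^sub>0 = P0 h + Q0 z\<^sub>0 + (\<parallel>h\<parallel> + \<parallel>z\<^sub>0\<parallel>) \<epsilon>\<close>. Since \<open>z\<^sub>0\<close> lies in \<open>range j0\<close>, where
  \<open>Id - Q0\<close> agrees with \<open>T\<close>, this reads
  \<open>z\<^sub>0 = T\<^sup>-\<^sup>1 (P0 h) + (\<parallel>h\<parallel> + \<parallel>z\<^sub>0\<parallel>) T\<^sup>-\<^sup>1 \<epsilon>\<close>. Continuity of \<open>\<phi>1\<close> in the strong norm of \<open>X\<^sub>1\<close> is what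
  makes \<open>\<epsilon>\<close> tend to \<open>0\<close>; since the factor \<open>\<parallel>h\<parallel> + \<parallel>z\<^sub>0\<parallel>\<close> measures \<open>z\<^sub>0\<close> in the weak norm
  of \<open>X\<^sub>0\<close>, in which the equation holds, the term \<open>\<parallel>z\<^sub>0\<parallel>\<close> can be absorbed to the left, whence \<open>z\<^sub>0 = O(\<parallel>h\<parallel>)\<close> and then
  \<open>z\<^sub>0 = T\<^sup>-\<^sup>1 (P0 h) + o(\<parallel>h\<parallel>)\<close> (\<open>has_derivative_self_bounded_remainder\<close>).

  Invertibility of \<open>T\<close> is algebraic (\<open>bij T\<close>), while the argument needs \<open>T\<^sup>-\<^sup>1\<close> to be
  bounded. This is the bounded inverse theorem (\<open>bounded_linear_inv\<close>), obtained here from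
  Baire's theorem by the classical route: solve \<open>T x = y\<close> up to an error \<open>\<parallel>y\<parallel> / 2\<close> with control on
  \<open>\<parallel>x\<parallel>\<close>, then sum the successive corrections.
\<close>

section \<open>The bounded inverse theorem\<close>

text \<open>
  By surjectivity the closures of the images of the balls of radius \<open>n\<close> cover the target, so Baire
  gives one of them an interior point. Differences of points in that image then approximate all
  short vectors, and scaling reaches every \<open>y\<close>.
\<close>

lemma surj_bounded_linear_approximate_solution:
  fixes T :: "'a::real_normed_vector \<Rightarrow> 'b::banach"
  assumes "bounded_linear T" and "surj T"
  obtains K where "K \<ge> 0"
    and "\<And>y. \<exists>x. norm x \<le> K * norm y \<and> norm (y - T x) \<le> norm y / 2"
proof -
  interpret T: bounded_linear T by fact
  let ?C = "\<lambda>n::nat. closure (T ` cball 0 (real n))"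
  have "\<exists>n. interior (?C n) \<noteq> {}"
  proof (rule ccontr)
    assume "\<nexists>n. interior (?C n) \<noteq> {}"
    then have "euclidean interior_of \<Union>(range ?C) = {}"
      by (intro Baire_category_alt disjI1 completely_metrizable_space_euclidean) auto
    moreover have "\<Union>(range ?C) = UNIV"
    proof (intro set_eqI iffI UNIV_I)
      fix y
      obtain x where x: "y = T x" using \<open>surj T\<close> by (rule surjE)
      obtain n :: nat where "norm x \<le> real n" using real_arch_simple by blast
      then have "y \<in> T ` cball 0 (real n)" using x by auto
      then have "y \<in> ?C n" by (rule subsetD[OF closure_subset])
      then show "y \<in> \<Union>(range ?C)" by blast
    qed
    ultimately show False by simp
  qed
  then obtain n c r where r: "r > 0" "ball c r \<subseteq> ?C n"
    by (meson all_not_in_conv interior_subset open_contains_ball open_interior order_trans)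
  have approx: "\<exists>x. norm x \<le> real n \<and> norm (T x - v) < r / 8" if "v \<in> ball c r" for v
  proof -
    have "v \<in> ?C n" using that r by blast
    then obtain w where "w \<in> T ` cball 0 (real n)" "dist w v < r / 8"
      using r(1) by (meson closure_approachable divide_pos_pos zero_less_numeral)
    then show ?thesis by (auto simp: dist_norm)
  qed
  show thesis
  proof
    show "4 * real n / r \<ge> 0" using r by simp
  next
    fix y
    show "\<exists>x. norm x \<le> 4 * real n / r * norm y \<and> norm (y - T x) \<le> norm y / 2"
    proof (cases "y = 0")
      case True
      then show ?thesis by (intro exI[of _ 0]) (simp add: T.zero)
    next
      case False
      \<comment> \<open>The multiple of \<open>y\<close> of length \<open>r / 2\<close>, which leads from the centre \<open>c\<close> to a point of the ball.\<close>
      define t where "t = r / (2 * norm y)"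
      have t: "t > 0" "t * norm y = r / 2" using False r by (auto simp: t_def)
      have "c + t *\<^sub>R y \<in> ball c r" "c \<in> ball c r" using t r by (auto simp: dist_norm)
      then obtain x1 x2 where x: "norm x1 \<le> real n" "norm (T x1 - (c + t *\<^sub>R y)) < r / 8"
          "norm x2 \<le> real n" "norm (T x2 - c) < r / 8"
        using approx by metis
      define x where "x = (1 / t) *\<^sub>R (x1 - x2)"
      have "norm (x1 - x2) \<le> 2 * real n"
        using norm_triangle_ineq4[of x1 x2] x by linarith
      then have "norm x \<le> 2 * real n / t"
        using t by (simp add: x_def divide_right_mono)
      also have "\<dots> = 4 * real n / r * norm y"
        using False r by (simp add: t_def)
      finally have bound: "norm x \<le> 4 * real n / r * norm y" .
      have "t *\<^sub>R (y - T x) = (T x2 - c) - (T x1 - (c + t *\<^sub>R y))"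
        using t by (simp add: x_def T.scale T.diff algebra_simps)
      then have "norm (t *\<^sub>R (y - T x)) \<le> norm (T x2 - c) + norm (T x1 - (c + t *\<^sub>R y))"
        by (metis norm_triangle_ineq4)
      then have "t * norm (y - T x) \<le> r / 4"
        using x t(1) by simp
      also have "\<dots> = t * (norm y / 2)"
        using t(2) by simp
      finally have "norm (y - T x) \<le> norm y / 2"
        using t(1) by simp
      with bound show ?thesis by blast
    qed
  qed
qed

text \<open>
  Each residual \<open>\<rho> n\<close> is at most half of its predecessor, so the corrections, which are bounded by
  a multiple of the residuals, form an absolutely convergent series; its sum exists because
  the domain is complete.
\<close>

lemma surj_bounded_linear_bounded_solution:
  fixes T :: "'a::banach \<Rightarrow> 'b::banach"
  assumes "bounded_linear T" and "surj T"
  obtains K where "\<And>y. \<exists>x. T x = y \<and> norm x \<le> K * norm y"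
proof -
  interpret T: bounded_linear T by fact
  obtain K where K: "K \<ge> 0"
    and "\<And>y. \<exists>x. norm x \<le> K * norm y \<and> norm (y - T x) \<le> norm y / 2"
    using surj_bounded_linear_approximate_solution[OF assms] by metis
  then obtain g where g: "\<And>y. norm (g y) \<le> K * norm y"
    and half: "\<And>y. norm (y - T (g y)) \<le> norm y / 2"
    by metis
  show thesis
  proof
    fix y
    define \<rho> where "\<rho> n = ((\<lambda>z. z - T (g z)) ^^ n) y" for n
    have \<rho>_simps: "\<rho> 0 = y" "\<And>n. \<rho> (Suc n) = \<rho> n - T (g (\<rho> n))"
      by (simp_all add: \<rho>_def)
    have \<rho>_le: "norm (\<rho> n) \<le> norm y * (1/2) ^ n" for n
    proof (induction n)
      case (Suc n)
      then show ?case using half[of "\<rho> n"] by (simp add: \<rho>_simps)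
    qed (simp add: \<rho>_simps)
    have term_le: "norm (g (\<rho> n)) \<le> K * norm y * (1/2) ^ n" for n
      using order_trans[OF g[of "\<rho> n"] mult_left_mono[OF \<rho>_le[of n] K]] by (simp add: mult.assoc)
    have geo: "(\<lambda>n. K * norm y * (1/2) ^ n) sums (K * norm y * 2)"
      using sums_mult[OF geometric_sums[of "1/2::real"], of "K * norm y"] by simp
    have summ: "summable (\<lambda>n. norm (g (\<rho> n)))"
      using term_le by (intro summable_comparison_test'[OF sums_summable[OF geo]]) simp
    let ?x = "\<Sum>n. g (\<rho> n)"
    have "norm ?x \<le> (\<Sum>n. norm (g (\<rho> n)))" by (rule summable_norm[OF summ])
    also have "\<dots> \<le> K * norm y * 2"
      using suminf_le[OF term_le summ sums_summable[OF geo]] sums_unique[OF geo] by simp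
    finally have bound: "norm ?x \<le> 2 * K * norm y" by (simp add: mult_ac)
    have "(\<lambda>n. norm y * (1/2) ^ n) \<longlonglongrightarrow> norm y * 0"
      by (intro tendsto_intros LIMSEQ_realpow_zero) auto
    then have "\<rho> \<longlonglongrightarrow> 0"
      using \<rho>_le by (intro Lim_null_comparison[of \<rho>]) auto
    then have "(\<lambda>n. \<rho> n - \<rho> (Suc n)) sums (\<rho> 0 - 0)"
      by (rule telescope_sums')
    then have "(\<lambda>n. T (g (\<rho> n))) sums y"
      by (simp add: \<rho>_simps)
    moreover have "(\<lambda>n. T (g (\<rho> n))) sums T ?x"
      by (intro T.sums summable_sums summable_norm_cancel[OF summ])
    ultimately have "T ?x = y" by (rule sums_unique2[symmetric])
    with bound show "\<exists>x. T x = y \<and> norm x \<le> 2 * K * norm y" by blast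
  qed
qed

theorem bounded_linear_inv:
  fixes T :: "'a::banach \<Rightarrow> 'b::banach"
  assumes "bounded_linear T" and "bij T"
  shows "bounded_linear (inv T)"
proof -
  interpret T: bounded_linear T by fact
  have inv_eq: "inv T y = x" if "T x = y" for x y
    using that \<open>bij T\<close> by (simp add: bij_is_inj inv_f_eq)
  have T_inv: "T (inv T y) = y" for y
    using \<open>bij T\<close> by (simp add: bij_is_surj surj_f_inv_f)
  obtain K where K: "\<And>y. \<exists>x. T x = y \<and> norm x \<le> K * norm y"
    using surj_bounded_linear_bounded_solution assms bij_is_surj by metis
  show ?thesis
  proof (rule bounded_linear_intro)
    show "inv T (x + y) = inv T x + inv T y" for x y
      by (rule inv_eq) (simp add: T.add T_inv)
    show "inv T (c *\<^sub>R x) = c *\<^sub>R inv T x" for c x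
      by (rule inv_eq) (simp add: T.scale T_inv)
    show "norm (inv T y) \<le> norm y * K" for y
      using K[of y] inv_eq by (auto simp: mult.commute)
  qed
qed

section \<open>Differentiability from a remainder involving the increment itself\<close>

text \<open>
  The remainder may be small relative to the increment of \<open>f\<close> and not only relative to \<open>y - x\<close>:
  once \<open>\<parallel>R y\<parallel> \<le> 1/2\<close>, the increment on the right is absorbed into the left-hand side, which bounds
  it by a multiple of \<open>\<parallel>y - x\<parallel>\<close>.
\<close>

lemma has_derivative_self_bounded_remainder:
  fixes f :: "'a::real_normed_vector \<Rightarrow> 'b::real_normed_vector"
  assumes lin: "bounded_linear f'"
    and expansion: "\<And>y. y \<in> S \<Longrightarrow>
      f y - f x = f' (y - x) + (norm (y - x) + norm (f y - f x)) *\<^sub>R R y"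
    and R: "(R \<longlongrightarrow> 0) (at x within S)"
  shows "(f has_derivative f') (at x within S)"
proof (rule has_derivativeI[OF lin])
  obtain C where C: "\<And>h. norm (f' h) \<le> norm h * C"
    using bounded_linear.bounded[OF lin] by blast
  have "eventually (\<lambda>y. norm (R y) < 1/2) (at x within S)"
    using tendstoD[OF R, of "1/2"] by (simp add: dist_norm)
  moreover have "eventually (\<lambda>y. y \<in> S \<and> y \<noteq> x) (at x within S)"
    by (auto simp: eventually_at_filter)
  ultimately have "eventually (\<lambda>y. norm ((f y - f x - f' (y - x)) /\<^sub>R norm (y - x))
      \<le> (2 * C + 2) * norm (R y)) (at x within S)"
  proof eventually_elim
    fix y
    assume half: "norm (R y) < 1/2" and y: "y \<in> S \<and> y \<noteq> x"
    define k where "k = norm (y - x)"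
    define d where "d = norm (f y - f x)"
    have kd: "k > 0" "d \<ge> 0" using y by (auto simp: k_def d_def)
    have remainder: "f y - f x - f' (y - x) = (k + d) *\<^sub>R R y"
      using expansion[of y] y unfolding k_def d_def by (metis add_diff_cancel_left')
    have "d \<le> norm (f' (y - x)) + norm ((k + d) *\<^sub>R R y)"
      using norm_triangle_sub[of "f y - f x" "f' (y - x)"] unfolding remainder d_def .
    also have "\<dots> \<le> k * C + (k + d) * (1/2)"
      using C[of "y - x"] mult_left_mono[of "norm (R y)" "1/2" "k + d"] half kd
      by (intro add_mono) (simp_all add: k_def)
    finally have "k + d \<le> (2 * C + 2) * k" by (simp add: field_simps)
    then have "(k + d) / k \<le> 2 * C + 2"
      using kd by (simp only: pos_divide_le_eq)
    then have "(k + d) / k * norm (R y) \<le> (2 * C + 2) * norm (R y)"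
      by (rule mult_right_mono) simp
    then show "norm ((f y - f x - f' (y - x)) /\<^sub>R norm (y - x)) \<le> (2 * C + 2) * norm (R y)"
      using kd unfolding remainder k_def[symmetric] by (simp add: divide_inverse mult_ac)
  qed
  moreover have "((\<lambda>y. (2 * C + 2) * norm (R y)) \<longlongrightarrow> 0) (at x within S)"
    using tendsto_mult_right_zero[OF tendsto_norm_zero[OF R]] .
  ultimately show "((\<lambda>y. (f y - f x - f' (y - x)) /\<^sub>R norm (y - x)) \<longlongrightarrow> 0) (at x within S)"
    by (rule Lim_null_comparison)
qed

section \<open>Differentiability of the fixed point\<close>

theorem theorem1:
  fixes j0 :: "'x1::banach \<Rightarrow> 'x0::banach"
    and A1 :: "'x1 set" and A0 :: "'x0 set"
    and u0 :: "'b::banach" and U :: "'b set"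
    and F0 :: "'b \<Rightarrow> 'x0 \<Rightarrow> 'x0" and F1 :: "'b \<Rightarrow> 'x1 \<Rightarrow> 'x1"
    and \<phi>0 :: "'b \<Rightarrow> 'x0" and \<phi>1 :: "'b \<Rightarrow> 'x1"
    and P0 :: "'b \<Rightarrow> 'x0" and Q0 :: "'x0 \<Rightarrow> 'x0"
    and \<epsilon> :: "'b \<Rightarrow> 'x1 \<Rightarrow> 'x0"
    and T :: "'x0 \<Rightarrow> 'x0"
  assumes "bounded_linear j0" and "inj j0"
    and "closed A1" and "A1 \<noteq> {}" and "A0 = j0 ` A1"
    and "u0 \<in> interior U"
    and "\<And>u x. u \<in> U \<Longrightarrow> x \<in> A0 \<Longrightarrow> F0 u x \<in> A0"
    and "\<And>u x. u \<in> U \<Longrightarrow> x \<in> A1 \<Longrightarrow> F1 u x \<in> A1"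
    and "continuous_on (U \<times> A0) (\<lambda>(u, x). F0 u x)"
    and "continuous_on (U \<times> A1) (\<lambda>(u, x). F1 u x)"
    and "\<And>u x. u \<in> U \<Longrightarrow> x \<in> A1 \<Longrightarrow> F0 u (j0 x) = j0 (F1 u x)"
    and "\<And>u. u \<in> U \<Longrightarrow> \<phi>1 u \<in> A1 \<and> F1 u (\<phi>1 u) = \<phi>1 u"
    and "continuous_on U \<phi>1"
    and "\<And>u. u \<in> U \<Longrightarrow> \<phi>0 u = j0 (\<phi>1 u)"
    and "bounded_linear P0" and "bounded_linear_on (range j0) Q0"
    and "\<And>h z1. u0 + h \<in> U \<Longrightarrow> \<phi>1 u0 + z1 \<in> A1 \<Longrightarrow>
           F0 (u0 + h) (\<phi>0 u0 + j0 z1) - F0 u0 (\<phi>0 u0) =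
             P0 h + Q0 (j0 z1) + (norm h + norm (j0 z1)) *\<^sub>R \<epsilon> h z1"
    and "((\<lambda>(h, z1). \<epsilon> h z1) \<longlongrightarrow> 0)
           (at (0, 0) within {(h, z1). u0 + h \<in> U \<and> \<phi>1 u0 + z1 \<in> A1})"
    and "bounded_linear T" and "bij T" and "\<And>x. x \<in> range j0 \<Longrightarrow> T x = x - Q0 x"
  shows "\<phi>0 differentiable (at u0 within U) \<and>
         frechet_derivative \<phi>0 (at u0 within U) = (\<lambda>h. inv T (P0 h))"
proof -
  note F0_F1 = assms(11) and fixed = assms(12) and \<phi>0_eq = assms(14)
    and expansion = assms(17) and T_eq = assms(21)
  interpret j0: bounded_linear j0 by fact
  interpret S: bounded_linear "inv T"
    using bounded_linear_inv \<open>bounded_linear T\<close> \<open>bij T\<close> .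
  have u0: "u0 \<in> U" using \<open>u0 \<in> interior U\<close> interior_subset by blast
  have fixed0: "F0 u (\<phi>0 u) = \<phi>0 u" if "u \<in> U" for u
    using F0_F1[OF that] fixed[OF that] \<phi>0_eq[OF that] by metis
  let ?D = "{(h, z1). u0 + h \<in> U \<and> \<phi>1 u0 + z1 \<in> A1}"
  let ?R = "\<lambda>u. \<epsilon> (u - u0) (\<phi>1 u - \<phi>1 u0)"
  have increment: "\<phi>0 u - \<phi>0 u0 = inv T (P0 (u - u0)) +
      (norm (u - u0) + norm (\<phi>0 u - \<phi>0 u0)) *\<^sub>R inv T (?R u)" if u: "u \<in> U" for u
  proof -
    define z where "z = \<phi>0 u - \<phi>0 u0"
    have z: "z = j0 (\<phi>1 u - \<phi>1 u0)"
      using \<phi>0_eq u u0 by (simp add: z_def j0.diff)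
    define E where "E = (norm (u - u0) + norm z) *\<^sub>R ?R u"
    have "z = P0 (u - u0) + Q0 z + E"
      using expansion[of "u - u0" "\<phi>1 u - \<phi>1 u0"] fixed[OF u] fixed0 u u0
      unfolding E_def z[symmetric] by (simp add: z_def)
    then have "z - Q0 z = P0 (u - u0) + E"
      unfolding diff_eq_eq by (rule trans) (simp only: ac_simps)
    moreover have "T z = z - Q0 z" using T_eq z by blast
    ultimately have "z = inv T (P0 (u - u0) + E)"
      using \<open>bij T\<close> by (metis bij_is_inj inv_f_f)
    then show ?thesis unfolding z_def[symmetric] E_def by (simp only: S.add S.scale)
  qed
  have "(\<phi>1 \<longlongrightarrow> \<phi>1 u0) (at u0 within U)"
    using \<open>continuous_on U \<phi>1\<close> u0 by (simp add: continuous_on)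
  then have "((\<lambda>u. (u - u0, \<phi>1 u - \<phi>1 u0)) \<longlongrightarrow> (u0 - u0, \<phi>1 u0 - \<phi>1 u0)) (at u0 within U)"
    by (intro tendsto_intros)
  \<comment> \<open>The first component vanishes only at \<open>u = u0\<close>, so the path avoids the point \<open>(0, 0)\<close>, where
    \<open>\<epsilon>\<close> is not controlled.\<close>
  then have "filterlim (\<lambda>u. (u - u0, \<phi>1 u - \<phi>1 u0)) (at (0, 0) within ?D) (at u0 within U)"
    using fixed by (auto simp: filterlim_at eventually_at_filter)
  from filterlim_compose[OF assms(18) this] have "(?R \<longlongrightarrow> 0) (at u0 within U)"
    by simp
  then have "((\<lambda>u. inv T (?R u)) \<longlongrightarrow> 0) (at u0 within U)"
    by (rule S.tendsto_zero)
  with increment have deriv: "(\<phi>0 has_derivative (\<lambda>h. inv T (P0 h))) (at u0 within U)"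
    by (intro has_derivative_self_bounded_remainder bounded_linear_compose[OF S.bounded_linear]
        \<open>bounded_linear P0\<close>)
  \<comment> \<open>The derivative within \<open>U\<close> is unique because \<open>u0\<close> is interior.\<close>
  have "at u0 within U = at u0"
    using \<open>u0 \<in> interior U\<close> by (rule at_within_interior)
  with deriv show ?thesis
    using frechet_derivative_at by (metis differentiable_def)
qed

end
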